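(* For $k=0,1$ let $\Psi^k(\xi)$ and $\widetilde\Psi^{1-k}(\xi)=\Psi^k(\xi)\,(\mathbb M^{(k)})^{-1}$ be the primal and dual bases (row vectors) on $K=[-1,1]$ defined in the context. These bases are bi-orthogonal with respect to each other: $$\int_K\widetilde\Psi^{1-k}(\xi)^\intercal\,\Psi^k(\xi)\,\mathrm dK=\mathbb I,\qquad k=0,1,$$ where $\mathbb I$ is the $(N+1)\times(N+1)$ identity matrix for $k=0$ and the $N\times N$ identity matrix for $k=1$.
   Context: Let $\xi_0<\dots<\xi_N$ be the roots in $K=[-1,1]$ of $(1-\xi^2)L_N'(\xi)$, with $L_N$ the Legendre polynomial of degree $N\ge1$ (Gauss–Lobatto–Legendre nodes). $h_0,\dots,h_N$ are the Lagrange polynomials of degree $N$ through these nodes, $h_i(\xi_j)=\delta_{ij}$, and $e_j=-\sum_{k=0}^{j-1}\frac{\mathrm dh_k}{\mathrm d\xi}$, $j=1,\dots,N$, are the edge polynomials. $\Psi^0=(h_0\ \cdots\ h_N)$ and $\Psi^1=(e_1\ \cdots\ e_N)$ are row vectors of functions, and $\mathbb M^{(k)}=\int_K\Psi^k(\xi)^\intercal\Psi^k(\xi)\,\mathrm dK$ is the mass (Gram) matrix. *)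

theory Defs
  imports
    "HOL-Analysis.Analysis"
    "HOL-Computational_Algebra.Polynomial"
    "Jordan_Normal_Form.Gauss_Jordan_Elimination"
begin

hide_const (open) Finite_Cartesian_Product.mat Module.smult

text \<open>Legendre polynomials, by Rodrigues' formula.\<close>

definition legendre :: "nat \<Rightarrow> real poly" where
  "legendre n = smult (1 / (2 ^ n * fact n)) ((pderiv ^^ n) ([:-1, 0, 1:] ^ n))"

text \<open>
  Gauss-Lobatto-Legendre nodes, counted from 0 in increasing order. For \<open>n \<ge> 1\<close> the set of
  roots is finite and has exactly \<open>n + 1\<close> elements; only the indices \<open>i \<le> n\<close> are meaningful.
\<close>

definition gll_node :: "nat \<Rightarrow> nat \<Rightarrow> real" where
  "gll_node n i =
     sorted_list_of_set {x \<in> {-1..1}. (1 - x\<^sup>2) * poly (pderiv (legendre n)) x = 0} ! i"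

definition lagrange_poly :: "nat \<Rightarrow> nat \<Rightarrow> real poly" where
  "lagrange_poly n i =
     (\<Prod>j \<in> {..n} - {i}. smult (1 / (gll_node n i - gll_node n j)) [:- gll_node n j, 1:])"

definition edge_poly :: "nat \<Rightarrow> nat \<Rightarrow> real poly" where
  "edge_poly n j = - (\<Sum>k<j. pderiv (lagrange_poly n k))"

definition basis_size :: "nat \<Rightarrow> nat \<Rightarrow> nat" where
  "basis_size n k = (if k = 0 then n + 1 else n)"

text \<open>
  A row vector of functions is a function of the point with values in the matrices with one row.
  Matrix indices start at 0, so column \<open>j\<close> of the edge basis holds the edge polynomial with
  index \<open>j + 1\<close>. In everything below, \<open>k\<close> ranges over \<open>{0, 1}\<close>.
\<close>

definition primal_basis :: "nat \<Rightarrow> nat \<Rightarrow> real \<Rightarrow> real mat" where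
  "primal_basis n k x =
     mat 1 (basis_size n k)
       (\<lambda>(_, j). poly (if k = 0 then lagrange_poly n j else edge_poly n (Suc j)) x)"

text \<open>Entrywise integral of a function with values in the \<open>nr \<times> nc\<close> matrices.\<close>

definition mat_integral :: "nat \<Rightarrow> nat \<Rightarrow> real set \<Rightarrow> (real \<Rightarrow> real mat) \<Rightarrow> real mat" where
  "mat_integral nr nc S F = mat nr nc (\<lambda>(i, j). integral S (\<lambda>x. F x $$ (i, j)))"

definition mass_matrix :: "nat \<Rightarrow> nat \<Rightarrow> real mat" where
  "mass_matrix n k =
     mat_integral (basis_size n k) (basis_size n k) {-1..1}
       (\<lambda>x. transpose_mat (primal_basis n k x) * primal_basis n k x)"

text \<open>
  The dual basis of degree \<open>1 - k\<close> belongs to the primal basis of degree \<open>k\<close>; hence the dual basis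
  of degree \<open>l\<close> is formed from the primal basis of degree \<open>1 - l\<close>.
\<close>

definition dual_basis :: "nat \<Rightarrow> nat \<Rightarrow> real \<Rightarrow> real mat" where
  "dual_basis n l x = primal_basis n (1 - l) x * the (mat_inverse (mass_matrix n (1 - l)))"

end

theory Submission
  imports Defs "Jordan_Normal_Form.Determinant"
begin

hide_const (open) Finite_Cartesian_Product.mat Module.smult

text \<open>
  Since the Gram matrix \<open>M\<close> is symmetric, bi-orthogonality reads \<open>(M M\<^sup>-\<^sup>1)\<^sup>T = I\<close>, and the content
  of the statement is that \<open>M\<close> is invertible, i.e. that the primal bases are linearly
  independent. A vector in the kernel of \<open>M\<close> gives a combination of the basis with zero
  \<open>L\<^sup>2\<close>-norm, hence the zero polynomial. For the Lagrange polynomials, evaluate at the nodes. The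
  edge polynomials are the derivatives of \<open>- (h\<^sub>0 + \<dots> + h\<^sub>j)\<close>, which all vanish at the last node,
  so a vanishing combination of them integrates to a vanishing combination of these primitives.
  All this needs \<open>N + 1\<close> distinct nodes, which Rolle's theorem, applied repeatedly to
  \<open>(x\<^sup>2 - 1)\<^sup>N\<close>, provides.
\<close>

section \<open>The nodes\<close>

text \<open>Induction that adds the largest point: the mean value theorem between the old maximum
  and the new point gives a root to the right of all earlier ones. The bounds by points of
  \<open>S\<close> keep the new roots strictly inside the interval when the lemma is
  iterated.\<close>

lemma pderiv_roots_Rolle:
  fixes q :: "real poly"
  assumes "finite S" "\<And>x. x \<in> S \<Longrightarrow> poly q x = 0"
  shows "\<exists>T. finite T \<and> card S \<le> Suc (card T) \<and>
           (\<forall>t\<in>T. poly (pderiv q) t = 0 \<and> (\<exists>x\<in>S. \<exists>y\<in>S. x < t \<and> t < y))"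
  using assms
proof (induction S rule: finite_linorder_max_induct)
  case empty
  then show ?case by (intro exI[of _ "{}"]) simp
next
  case (insert b A)
  obtain T where T: "finite T" "card A \<le> Suc (card T)"
    "\<And>t. t \<in> T \<Longrightarrow> poly (pderiv q) t = 0 \<and> (\<exists>x\<in>A. \<exists>y\<in>A. x < t \<and> t < y)"
    using insert by auto
  show ?case
  proof (cases "A = {}")
    case True
    then show ?thesis by (intro exI[of _ "{}"]) simp
  next
    case False
    define m where "m = Max A"
    have m: "m \<in> A" "m < b" using insert(1,2) False by (auto simp: m_def)
    obtain z where z: "m < z" "z < b" "poly q b - poly q m = (b - m) * poly (pderiv q) z"
      using poly_MVT[OF m(2)] by blast
    have z0: "poly (pderiv q) z = 0" using z(3) m insert.prems by auto
    have "z \<notin> T"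
    proof
      assume "z \<in> T"
      then obtain y where "y \<in> A" "z < y" using T(3) by blast
      moreover have "y \<le> m" using \<open>y \<in> A\<close> insert(1) by (simp add: m_def)
      ultimately show False using z(1) by simp
    qed
    moreover have "b \<notin> A" using insert(2) by blast
    ultimately have "card (insert b A) \<le> Suc (card (insert z T))"
      using T(1,2) insert(1) by simp
    moreover have "\<forall>t\<in>insert z T. poly (pderiv q) t = 0 \<and>
        (\<exists>x\<in>insert b A. \<exists>y\<in>insert b A. x < t \<and> t < y)"
      using T(3) z z0 m by blast
    ultimately show ?thesis using T(1) by (intro exI[of _ "insert z T"]) blast
  qed
qed

text \<open>Each differentiation costs at most one factor \<open>p\<close>, so the derivatives of
  \<open>(x^2 - 1)^n\<close> of order below \<open>n\<close> still vanish at both endpoints.\<close>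

lemma power_dvd_higher_pderiv:
  fixes p :: "real poly"
  shows "k \<le> n \<Longrightarrow> p ^ (n - k) dvd (pderiv ^^ k) (p ^ n)"
proof (induction k)
  case (Suc k)
  then obtain r where r: "(pderiv ^^ k) (p ^ n) = p ^ Suc (n - Suc k) * r"
    by (metis Suc_diff_Suc Suc_leD Suc_le_lessD dvd_def)
  have "(pderiv ^^ Suc k) (p ^ n) = pderiv (p ^ Suc (n - Suc k) * r)" by (simp add: r)
  also have "\<dots> = p ^ (n - Suc k) *
      (p * pderiv r + smult (of_nat (Suc (n - Suc k))) (r * pderiv p))"
    unfolding pderiv_mult pderiv_power_Suc by (simp add: algebra_simps)
  finally show ?case by (rule dvdI)
qed simp

text \<open>Below order \<open>n\<close>, the endpoints -1 and 1 join at least \<open>k\<close>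
  interior roots, and Rolle turns these \<open>k + 2\<close> points into \<open>k + 1\<close>
  interior roots of the next derivative.\<close>

lemma roots_higher_pderiv_square_minus_one:
  "k \<le> n \<Longrightarrow> \<exists>T. finite T \<and> k \<le> card T \<and> T \<subseteq> {-1<..<1} \<and>
     (\<forall>t\<in>T. poly ((pderiv ^^ k) ([:-1, 0, 1:] ^ n)) t = (0::real))"
proof (induction k)
  case (Suc k)
  define q :: "real poly" where "q = (pderiv ^^ k) ([:-1, 0, 1:] ^ n)"
  obtain T where T: "finite T" "k \<le> card T" "T \<subseteq> {-1<..<1}" "\<forall>t\<in>T. poly q t = 0"
    using Suc q_def by auto
  have "[:-1, 0, 1:] ^ (n - k) dvd q"
    unfolding q_def using Suc.prems by (intro power_dvd_higher_pderiv) simp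
  then obtain r where "q = [:-1, 0, 1:] ^ (n - k) * r" by (rule dvdE)
  then have "poly q 1 = 0" "poly q (-1) = 0" using Suc.prems by auto
  then obtain U where U: "finite U" "card (insert (-1) (insert 1 T)) \<le> Suc (card U)"
    "\<forall>t\<in>U. poly (pderiv q) t = 0 \<and>
       (\<exists>x\<in>insert (-1) (insert 1 T). \<exists>y\<in>insert (-1) (insert 1 T). x < t \<and> t < y)"
    using pderiv_roots_Rolle[of "insert (-1) (insert 1 T)" q] T by auto
  have "card (insert (-1) (insert 1 T)) = Suc (Suc (card T))"
  proof -
    have "1 \<notin> T" "-1 \<notin> insert 1 T" using T(3) by auto
    then show ?thesis using T(1) by simp
  qed
  then have "Suc k \<le> card U" using U(2) T(2) by simp
  moreover have "U \<subseteq> {-1<..<1}"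
  proof
    fix t assume "t \<in> U"
    then obtain x y where "x \<in> insert (-1) (insert 1 T)" "y \<in> insert (-1) (insert 1 T)"
      "x < t" "t < y" using U(3) by blast
    moreover from this have "-1 \<le> x" "y \<le> 1" using T(3) by auto
    ultimately show "t \<in> {-1<..<1}" by simp
  qed
  moreover have "\<forall>t\<in>U. poly ((pderiv ^^ Suc k) ([:-1, 0, 1:] ^ n)) t = (0::real)"
    using U(3) by (simp add: q_def)
  ultimately show ?case using U(1) by (intro exI[of _ U]) blast
qed (intro exI[of _ "{}"], simp)

lemma degree_legendre: "degree (legendre n) = n"
proof -
  have "degree ([:-1, 0, 1:] ^ n :: real poly) = 2 * n"
    by (simp add: degree_power_eq)
  then show ?thesis by (simp add: legendre_def degree_higher_pderiv)
qed

definition gll_roots :: "nat \<Rightarrow> real set" where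
  "gll_roots n = {x \<in> {-1..1}. (1 - x\<^sup>2) * poly (pderiv (legendre n)) x = 0}"

lemma finite_gll_roots:
  assumes "n \<ge> 1"
  shows "finite (gll_roots n)"
proof -
  have "pderiv (legendre n) \<noteq> 0"
    using assms by (simp add: pderiv_eq_0_iff degree_legendre)
  then have "[:1, 0, -1:] * pderiv (legendre n) \<noteq> 0"
    by (simp del: mult_pCons_left)
  then have "finite {x. poly ([:1, 0, -1:] * pderiv (legendre n)) x = 0}"
    by (rule poly_roots_finite)
  then show ?thesis
    by (rule rev_finite_subset) (auto simp: gll_roots_def power2_eq_square)
qed

text \<open>Rolle leaves at least \<open>n - 1\<close> roots of the Legendre derivative in the open
  interval; the factor \<open>1 - x^2\<close> adds the two endpoints.\<close>

lemma card_gll_roots: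
  assumes "n \<ge> 1"
  shows "n + 1 \<le> card (gll_roots n)"
proof -
  obtain T where T: "finite T" "n \<le> card T" "T \<subseteq> {-1<..<1}"
     "\<forall>t\<in>T. poly ((pderiv ^^ n) ([:-1, 0, 1:] ^ n)) t = (0::real)"
    using roots_higher_pderiv_square_minus_one[of n n] by auto
  then have "\<forall>t\<in>T. poly (legendre n) t = 0" by (simp add: legendre_def)
  then obtain U where U: "finite U" "card T \<le> Suc (card U)"
    "\<forall>t\<in>U. poly (pderiv (legendre n)) t = 0 \<and> (\<exists>x\<in>T. \<exists>y\<in>T. x < t \<and> t < y)"
    using pderiv_roots_Rolle[OF T(1), of "legendre n"] by blast
  have U1: "U \<subseteq> {-1<..<1}"
  proof
    fix t assume "t \<in> U"
    then obtain x y where "x \<in> T" "y \<in> T" "x < t" "t < y" using U(3) by blast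
    moreover from this have "-1 < x" "y < 1" using T(3) by auto
    ultimately show "t \<in> {-1<..<1}" by simp
  qed
  have "1 \<notin> U" "-1 \<notin> insert 1 U" using U1 by auto
  then have "card (insert (-1) (insert 1 U)) = Suc (Suc (card U))" using U(1) by simp
  moreover have "insert (-1) (insert 1 U) \<subseteq> gll_roots n"
    using U(3) U1 by (auto simp: gll_roots_def)
  ultimately have "Suc (Suc (card U)) \<le> card (gll_roots n)"
    using card_mono[OF finite_gll_roots[OF assms]] by metis
  then show ?thesis using U(2) T(2) by simp
qed

text \<open>Positions up to \<open>n\<close> lie inside the sorted list, whose entries are distinct;
  outside it \<open>!\<close> is unspecified. Hence the denominators of the Lagrange polynomials are
  nonzero.\<close>

lemma gll_node_eq_iff:
  assumes "n \<ge> 1" "i \<le> n" "j \<le> n"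
  shows "gll_node n i = gll_node n j \<longleftrightarrow> i = j"
proof -
  have "length (sorted_list_of_set (gll_roots n)) \<ge> n + 1"
    using card_gll_roots[OF assms(1)] by simp
  then show ?thesis
    using assms unfolding gll_node_def gll_roots_def[symmetric]
    by (intro nth_eq_iff_index_eq distinct_sorted_list_of_set) simp_all
qed

section \<open>Linear independence of the primal bases\<close>

lemma poly_lagrange_poly:
  assumes "n \<ge> 1" "i \<le> n" "j \<le> n"
  shows "poly (lagrange_poly n i) (gll_node n j) = (if i = j then 1 else 0)"
proof (cases "i = j")
  case True
  \<comment> \<open>Distinct nodes matter here: a zero denominator would make the factor 0, since
    \<open>x / 0 = 0\<close>.\<close>
  have "(\<Prod>l\<in>{..n} - {i}. (gll_node n i - gll_node n l) / (gll_node n i - gll_node n l)) = 1"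
    using assms by (intro prod.neutral) (auto simp: gll_node_eq_iff)
  then show ?thesis using True
    by (simp add: lagrange_poly_def poly_prod flip: diff_divide_distrib)
next
  case False
  then have "\<exists>l\<in>{..n} - {i}.
      poly (smult (1 / (gll_node n i - gll_node n l)) [:- gll_node n l, 1:]) (gll_node n j) = 0"
    using assms by (intro bexI[of _ j]) auto
  then show ?thesis using False
    by (simp add: lagrange_poly_def poly_prod)
qed

lemma lagrange_poly_independent:
  assumes "n \<ge> 1" "(\<Sum>i<n + 1. smult (c i) (lagrange_poly n i)) = 0" "j < n + 1"
  shows "c j = 0"
proof -
  have "0 = poly (\<Sum>i<n + 1. smult (c i) (lagrange_poly n i)) (gll_node n j)"
    using assms(2) by simp
  also have "\<dots> = (\<Sum>i<n + 1. c i * poly (lagrange_poly n i) (gll_node n j))"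
    by (simp only: poly_sum poly_smult)
  also have "\<dots> = (\<Sum>i<n + 1. if i = j then c i else 0)"
    using assms(1,3) by (intro sum.cong) (auto simp: poly_lagrange_poly)
  also have "\<dots> = c j" using assms(3) by (subst sum.delta) auto
  finally show ?thesis by simp
qed

text \<open>Up to sign these partial sums are primitives of the edge polynomials, so integrated
  combinations of the latter can be evaluated at the nodes.\<close>

lemma poly_sum_lagrange_poly:
  assumes "n \<ge> 1" "j < n" "i \<le> n"
  shows "poly (\<Sum>k<Suc j. lagrange_poly n k) (gll_node n i) = (if i \<le> j then 1 else 0)"
proof -
  have "poly (\<Sum>k<Suc j. lagrange_poly n k) (gll_node n i) = (\<Sum>k<Suc j. if k = i then 1 else 0)"
    unfolding poly_sum using assms by (intro sum.cong) (auto simp: poly_lagrange_poly)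
  also have "\<dots> = (if i \<le> j then 1 else 0)" by (subst sum.delta) auto
  finally show ?thesis .
qed

lemma edge_poly_independent:
  assumes n: "n \<ge> 1" and "(\<Sum>j<n. smult (c j) (edge_poly n (Suc j))) = 0" "i < n"
  shows "c i = 0"
proof -
  \<comment> \<open>Minus a primitive of the given combination, hence a constant polynomial.\<close>
  define P where "P = (\<Sum>j<n. smult (c j) (\<Sum>k<Suc j. lagrange_poly n k))"
  have "pderiv P = - (\<Sum>j<n. smult (c j) (edge_poly n (Suc j)))"
    unfolding P_def edge_poly_def
    by (simp add: pderiv_smult higher_pderiv_sum[of "Suc 0", simplified] sum_negf
             del: sum.lessThan_Suc)
  then have "pderiv P = 0" using assms(2) by simp
  then obtain a where "P = [:a:]" by (auto simp: pderiv_eq_0_iff elim: degree_eq_zeroE)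
  then have const: "poly P x = poly P y" for x y by simp
  have val: "poly P (gll_node n l) = (\<Sum>j<n. if l \<le> j then c j else 0)" if "l \<le> n" for l
    unfolding P_def poly_sum[of _ "{..<n}"] poly_smult
    using n that by (intro sum.cong) (simp_all add: poly_sum_lagrange_poly del: sum.lessThan_Suc)
  \<comment> \<open>The value at node \<open>l\<close> is the tail sum of the \<open>c j\<close>
    with \<open>l \<le> j\<close>, so neighbouring nodes isolate one coefficient;
    \<open>Suc i \<le> n\<close> because \<open>i < n\<close>.\<close>
  have "0 = poly P (gll_node n i) - poly P (gll_node n (Suc i))"
    using const[of "gll_node n i" "gll_node n (Suc i)"] by simp
  also have "\<dots> = (\<Sum>j<n. if j = i then c j else 0)"
    using assms(3)
    by (simp add: val flip: sum_subtractf del: sum.delta sum.delta') (intro sum.cong, auto)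
  also have "\<dots> = c i" using assms(3) by (subst sum.delta) auto
  finally show ?thesis by simp
qed

section \<open>Gram matrices of polynomials\<close>

lemma integrable_poly: "poly p integrable_on {a..b::real}"
  by (intro integrable_continuous_real continuous_intros)

text \<open>A continuous nonnegative function with zero integral vanishes on the whole interval,
  which is an infinite set of roots.\<close>

lemma poly_eq_0_if_integral_square_eq_0:
  fixes q :: "real poly"
  assumes "a < b" "integral {a..b} (\<lambda>x. poly q x * poly q x) = 0"
  shows "q = 0"
proof (rule ccontr)
  assume "q \<noteq> 0"
  then have "finite {x. poly q x = 0}" by (rule poly_roots_finite)
  moreover have "\<forall>x\<in>{a..b}. poly q x * poly q x = 0"
    using assms by (subst integral_eq_0_iff[symmetric]) (auto intro!: continuous_intros)
  then have "{a..b} \<subseteq> {x. poly q x = 0}" by auto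
  ultimately show False using assms(1) infinite_Icc finite_subset by blast
qed

text \<open>Linearity of the integral, with the scalars on the right so that \<open>c\<close> can be
  a kernel vector or a column of the inverse matrix.\<close>

lemma integral_poly_sum:
  fixes p :: "nat \<Rightarrow> real poly"
  shows "integral {a..b} (\<lambda>x. (\<Sum>l<m. poly (p l) x * c l) * poly q x)
    = (\<Sum>l<m. integral {a..b} (\<lambda>x. poly (p l) x * poly q x) * c l)"
proof -
  have "integral {a..b} (\<lambda>x. (\<Sum>l<m. poly (p l) x * c l) * poly q x)
      = integral {a..b} (\<lambda>x. \<Sum>l<m. poly (p l * q) x * c l)"
    by (simp add: sum_distrib_left sum_distrib_right mult_ac)
  also have "\<dots> = (\<Sum>l<m. integral {a..b} (\<lambda>x. poly (p l * q) x * c l))"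
    by (intro integral_sum integrable_on_mult_left integrable_poly) simp
  finally show ?thesis by simp
qed

definition gram_matrix :: "nat \<Rightarrow> (nat \<Rightarrow> real poly) \<Rightarrow> real mat" where
  "gram_matrix m p = mat m m (\<lambda>(i, j). integral {-1..1} (\<lambda>x. poly (p i) x * poly (p j) x))"

text \<open>A kernel vector yields a combination \<open>q\<close> orthogonal to every
  \<open>p i\<close>, hence to itself, so \<open>q = 0\<close>.\<close>

lemma det_gram_matrix_nonzero:
  assumes indep: "\<And>c j. (\<Sum>i<m. smult (c i) (p i)) = 0 \<Longrightarrow> j < m \<Longrightarrow> c j = 0"
  shows "det (gram_matrix m p) \<noteq> 0"
proof
  have car: "gram_matrix m p \<in> carrier_mat m m" by (simp add: gram_matrix_def)
  assume "det (gram_matrix m p) = 0"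
  then obtain v where v: "v \<in> carrier_vec m" "v \<noteq> 0\<^sub>v m" "gram_matrix m p *\<^sub>v v = 0\<^sub>v m"
    using det_0_iff_vec_prod_zero[OF car] by blast
  define c where "c = vec_index v"
  define q where "q = (\<Sum>i<m. smult (c i) (p i))"
  have q: "poly q x = (\<Sum>l<m. poly (p l) x * c l)" for x
    by (simp add: q_def poly_sum mult.commute)
  have ker: "integral {-1..1} (\<lambda>x. poly q x * poly (p i) x) = 0" if "i < m" for i
  proof -
    have "integral {-1..1} (\<lambda>x. poly q x * poly (p i) x)
        = (\<Sum>l<m. integral {-1..1} (\<lambda>x. poly (p l) x * poly (p i) x) * c l)"
      unfolding q by (rule integral_poly_sum)
    also have "\<dots> = vec_index (gram_matrix m p *\<^sub>v v) i"
      using that v(1)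
      by (auto simp: gram_matrix_def scalar_prod_def c_def atLeast0LessThan mult_ac intro!: sum.cong)
    finally show ?thesis using v(3) that by simp
  qed
  have "integral {-1..1} (\<lambda>x. poly q x * poly q x)
      = integral {-1..1} (\<lambda>x. (\<Sum>l<m. poly (p l) x * c l) * poly q x)"
    by (simp only: q)
  also have "\<dots> = (\<Sum>l<m. integral {-1..1} (\<lambda>x. poly (p l) x * poly q x) * c l)"
    by (rule integral_poly_sum)
  also have "\<dots> = 0" using ker by (intro sum.neutral) (simp add: mult.commute)
  finally have "q = 0" by (intro poly_eq_0_if_integral_square_eq_0[of "-1" 1]) auto
  then have "c j = 0" if "j < m" for j using indep that unfolding q_def by blast
  then have "v = 0\<^sub>v m" using v(1) by (intro eq_vecI) (auto simp: c_def)
  then show False using v(2) by contradiction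
qed

text \<open>Rules out \<open>None\<close>, so that \<open>the\<close> in \<open>dual_basis\<close>
  yields a true inverse.\<close>

lemma mat_inverse_gram_matrix:
  assumes "\<And>c j. (\<Sum>i<m. smult (c i) (p i)) = 0 \<Longrightarrow> j < m \<Longrightarrow> c j = 0"
  obtains B where "mat_inverse (gram_matrix m p) = Some B" "gram_matrix m p * B = 1\<^sub>m m"
    "B \<in> carrier_mat m m"
proof -
  have car: "gram_matrix m p \<in> carrier_mat m m" by (simp add: gram_matrix_def)
  have "det (gram_matrix m p) \<noteq> 0" using assms by (rule det_gram_matrix_nonzero)
  \<comment> \<open>In both facts the units belong to \<open>ring_mat\<close> with an arbitrary
    extra argument; taking \<open>()\<close> in both makes the rings agree.\<close>
  then have "mat_inverse (gram_matrix m p) \<noteq> None"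
    using mat_inverse(1)[OF car, of "()"] det_non_zero_imp_unit[OF car, of "()"] by blast
  then show ?thesis using that mat_inverse(2)[OF car] by blast
qed

section \<open>The two primal bases as polynomial families, and their bi-orthogonality\<close>

definition basis_poly :: "nat \<Rightarrow> nat \<Rightarrow> nat \<Rightarrow> real poly" where
  "basis_poly n k j = (if k = 0 then lagrange_poly n j else edge_poly n (Suc j))"

lemma primal_basis_basis_poly:
  "primal_basis n k x = mat 1 (basis_size n k) (\<lambda>(_, j). poly (basis_poly n k j) x)"
  by (simp add: primal_basis_def basis_poly_def)

lemma mass_matrix_gram_matrix: "mass_matrix n k = gram_matrix (basis_size n k) (basis_poly n k)"
  unfolding mass_matrix_def mat_integral_def gram_matrix_def primal_basis_basis_poly
  by (rule eq_matI) (auto simp: scalar_prod_def)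

lemma basis_poly_independent:
  assumes "n \<ge> 1" "(\<Sum>i<basis_size n k. smult (c i) (basis_poly n k i)) = 0" "j < basis_size n k"
  shows "c j = 0"
  using assms lagrange_poly_independent[of n c j] edge_poly_independent[of n c j]
  by (cases "k = 0") (simp_all add: basis_size_def basis_poly_def del: sum.lessThan_Suc)

theorem lemma2:
  fixes N k :: nat
  assumes "N \<ge> 1" and "k \<in> {0, 1}"
  shows "mat_integral (basis_size N k) (basis_size N k) {-1..1}
           (\<lambda>x. transpose_mat (dual_basis N (1 - k) x) * primal_basis N k x)
         = 1\<^sub>m (basis_size N k)"
proof -
  define m where "m = basis_size N k"
  define p where "p = basis_poly N k"
  obtain B where B: "mat_inverse (gram_matrix m p) = Some B" "gram_matrix m p * B = 1\<^sub>m m"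
    "B \<in> carrier_mat m m"
    using mat_inverse_gram_matrix[where m = m and p = p] basis_poly_independent[OF assms(1)]
    unfolding m_def p_def by blast
  \<comment> \<open>Subtraction on the naturals is truncated, so this needs
    \<open>k \<le> 1\<close>.\<close>
  have k: "1 - (1 - k) = k" using assms(2) by auto
  have dual: "dual_basis N (1 - k) x = primal_basis N k x * B" for x
    by (simp only: dual_basis_def k mass_matrix_gram_matrix B(1) option.sel flip: m_def p_def)
  have primal: "primal_basis N k x = mat 1 m (\<lambda>(_, j). poly (p j) x)" for x
    by (simp add: primal_basis_basis_poly m_def p_def)
  have entry: "(transpose_mat (primal_basis N k x * B) * primal_basis N k x) $$ (i, j)
      = (\<Sum>l<m. poly (p l) x * B $$ (l, i)) * poly (p j) x" if "i < m" "j < m" for i j x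
    using that B(3) by (simp add: primal scalar_prod_def atLeast0LessThan)
  have "integral {-1..1} (\<lambda>x. (\<Sum>l<m. poly (p l) x * B $$ (l, i)) * poly (p j) x)
      = 1\<^sub>m m $$ (i, j)" if "i < m" "j < m" for i j
  proof -
    have "integral {-1..1} (\<lambda>x. (\<Sum>l<m. poly (p l) x * B $$ (l, i)) * poly (p j) x)
        = (\<Sum>l<m. integral {-1..1} (\<lambda>x. poly (p l) x * poly (p j) x) * B $$ (l, i))"
      by (rule integral_poly_sum)
    \<comment> \<open>The integrals form the transpose of \<open>gram_matrix m p * B\<close>, as the
      two polynomials under each integral commute; the identity matrix is its own transpose.\<close>
    also have "\<dots> = (gram_matrix m p * B) $$ (j, i)"
      using that B(3)
      by (auto simp: gram_matrix_def scalar_prod_def atLeast0LessThan mult_ac intro!: sum.cong)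
    finally show ?thesis using that by (simp add: B(2) eq_commute)
  qed
  then show ?thesis
    unfolding mat_integral_def dual m_def[symmetric]
    by (intro eq_matI) (simp_all add: entry)
qed

end
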